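(* Let $a<b$ be real numbers. Suppose $f,g\in L^1([a,b])$, $\delta\in L^{\infty}([a,b])$ and $\delta(s)>0$ for almost all $s\in[a,b]$. Set $$\Omega=\Big\{\beta\in L^{\infty}([a,b]):\ \int_a^b\beta(s)\,ds=0,\ |\beta|\leqslant\delta\ \text{a.e.}\Big\},$$ and for $\beta\in\Omega$ let $b_\beta(s):=\int_a^s\beta(r)\,dr$. If $$\int_a^b \big(f(s)b_\beta(s)+g(s)\beta(s)\big)\,ds=0\qquad\text{for all }\beta\in\Omega,$$ then there exists a continuous representative $\tilde g$ of $g$ such that $\tilde g$ is absolutely continuous on $[a,b]$ and $\tilde g'(s)=f(s)$ for almost all $s\in[a,b]$.
   Context: All functions are real-valued; $L^p([a,b])$ is taken with respect to Lebesgue measure. A representative of $g$ is a function equal to $g$ almost everywhere. *)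

theory Defs
  imports "HOL-Analysis.Analysis" "HOL-Probability.Essential_Supremum"
begin

(* L_infinity is given by representatives. Measurability of f itself is required separately:
   a finite essential supremum only forces the absolute value of f to be measurable. *)
definition Linfinity :: "'a measure \<Rightarrow> ('a \<Rightarrow> real) set" where
  "Linfinity M = {f \<in> borel_measurable M. esssup M (\<lambda>x. ereal \<bar>f x\<bar>) < \<infinity>}"

definition Omega :: "real \<Rightarrow> real \<Rightarrow> (real \<Rightarrow> real) \<Rightarrow> (real \<Rightarrow> real) set" where
  "Omega a b \<delta> = {\<beta> \<in> Linfinity (lebesgue_on {a..b}).
     (LINT s|lebesgue_on {a..b}. \<beta> s) = 0 \<and>
     (AE s in lebesgue_on {a..b}. \<bar>\<beta> s\<bar> \<le> \<delta> s)}"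

definition primitive_from :: "real \<Rightarrow> (real \<Rightarrow> real) \<Rightarrow> real \<Rightarrow> real" where
  "primitive_from a \<beta> s = (LINT r|lebesgue_on {a..s}. \<beta> r)"

(* Absolute continuity of a function on {a..b}; unrelated to the library's absolutely_continuous,
   which is a relation between measures. *)
definition abs_continuous_on_interval :: "real \<Rightarrow> real \<Rightarrow> (real \<Rightarrow> real) \<Rightarrow> bool" where
  "abs_continuous_on_interval a b F \<longleftrightarrow>
     (\<forall>\<epsilon>>0. \<exists>\<eta>>0. \<forall>(n::nat) (l::nat \<Rightarrow> real) (r::nat \<Rightarrow> real).
        (\<forall>k<n. a \<le> l k \<and> l k < r k \<and> r k \<le> b) \<and>
        (\<forall>i<n. \<forall>j<n. i \<noteq> j \<longrightarrow> {l i<..<r i} \<inter> {l j<..<r j} = {}) \<and>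
        (\<Sum>k<n. r k - l k) < \<eta>
        \<longrightarrow> (\<Sum>k<n. \<bar>F (r k) - F (l k)\<bar>) < \<epsilon>)"

end

(* With F the primitive of f, Fubini's theorem turns the hypothesis into: the integral of
   (g - F) \<beta> vanishes for all \<beta> in Omega. The choice \<beta> = \<delta> (arctan (g - F) - m) / 4, where m is
   the \<delta>-weighted mean of arctan (g - F), has mean zero and is admissible. Writing m = arctan c,
   the nonnegative function \<delta> (g - F - c) (arctan (g - F) - arctan c) then has integral zero, so
   g = F + c almost everywhere. *)
theory Submission
  imports Defs
begin

section \<open>Absolute continuity of the primitive of an integrable function\<close>

text \<open>Truncation at height \<open>n\<close> gives
  \<open>\<bar>f\<bar> \<le> n + max (\<bar>f\<bar> - n) 0\<close>. The excess has small integral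
  for large \<open>n\<close> by dominated convergence, and over \<open>A\<close> the bounded part
  contributes at most \<open>n\<close> times the measure of \<open>A\<close>.\<close>

lemma set_integral_abs_small:
  fixes f :: "'a \<Rightarrow> real"
  assumes f: "integrable M f" and "\<epsilon> > 0"
  obtains \<eta> where "\<eta> > 0"
    "\<And>A. \<lbrakk>A \<in> sets M; emeasure M A < ennreal \<eta>\<rbrakk> \<Longrightarrow> (LINT x:A|M. \<bar>f x\<bar>) < \<epsilon>"
proof -
  have [measurable]: "f \<in> borel_measurable M" using f by auto
  have "(\<lambda>n. LINT x|M. max (\<bar>f x\<bar> - real n) 0) \<longlonglongrightarrow> (LINT x|M. 0)"
  proof (rule integral_dominated_convergence)
    show "integrable M (\<lambda>x. \<bar>f x\<bar>)" using f by simp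
    show "AE x in M. (\<lambda>n. max (\<bar>f x\<bar> - real n) 0) \<longlonglongrightarrow> 0"
    proof (rule AE_I2)
      fix x
      obtain N :: nat where N: "\<bar>f x\<bar> \<le> real N" using real_arch_simple by blast
      have "eventually (\<lambda>n. max (\<bar>f x\<bar> - real n) 0 = 0) sequentially"
        using eventually_ge_at_top[of N] by eventually_elim (use N in auto)
      then show "(\<lambda>n. max (\<bar>f x\<bar> - real n) 0) \<longlonglongrightarrow> 0"
        by (rule tendsto_eventually)
    qed
  qed auto
  then have "eventually (\<lambda>n. (LINT x|M. max (\<bar>f x\<bar> - real n) 0) < \<epsilon>/2) sequentially"
    using \<open>\<epsilon> > 0\<close> by (intro order_tendstoD(2)) auto
  then obtain n where n: "(LINT x|M. max (\<bar>f x\<bar> - real n) 0) < \<epsilon>/2"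
    by (auto simp: eventually_sequentially)
  \<comment> \<open>Chosen so that \<open>n * \<eta> \<le> \<epsilon>/2\<close>; the
    \<open>+ 1\<close> covers \<open>n = 0\<close>.\<close>
  define \<eta> where "\<eta> = \<epsilon> / (2 * (real n + 1))"
  show thesis
  proof
    show "\<eta> > 0" using \<open>\<epsilon> > 0\<close> by (simp add: \<eta>_def)
    fix A assume A[measurable]: "A \<in> sets M" and small: "emeasure M A < ennreal \<eta>"
    have fin: "emeasure M A < \<infinity>" using small less_trans by fastforce
    have "measure M A < \<eta>"
      using small fin \<open>\<eta> > 0\<close> by (metis emeasure_eq_ennreal_measure ennreal_less_iff infinity_ennreal_def less_irrefl measure_nonneg)
    then have "real n * measure M A \<le> real n * \<eta>" by (intro mult_left_mono) auto
    also have "\<dots> \<le> \<epsilon>/2" using \<open>\<epsilon> > 0\<close> by (simp add: \<eta>_def field_simps)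
    finally have 1: "real n * measure M A \<le> \<epsilon>/2" .
    have iA: "integrable M (\<lambda>x. real n * indicator A x)" 
      using fin by (intro integrable_mult_right integrable_real_indicator) auto
    have im: "integrable M (\<lambda>x. max (\<bar>f x\<bar> - real n) 0)"
      by (rule Bochner_Integration.integrable_bound[OF f]) auto
    have "(LINT x:A|M. \<bar>f x\<bar>) \<le> (LINT x|M. real n * indicator A x + max (\<bar>f x\<bar> - real n) 0)"
      unfolding set_lebesgue_integral_def
      by (rule integral_mono)
         (use f iA im in \<open>auto simp: indicator_def intro!: integrable_mult_indicator[of A M "\<lambda>x. \<bar>f x\<bar>", simplified]\<close>)
    also have "\<dots> = real n * measure M A + (LINT x|M. max (\<bar>f x\<bar> - real n) 0)"
      using iA im by simp
    finally show "(LINT x:A|M. \<bar>f x\<bar>) < \<epsilon>" using 1 n by simp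
  qed
qed

lemma primitive_from_diff:
  assumes f: "integrable (lebesgue_on {a..b}) f" and "a \<le> l" "l \<le> r" "r \<le> b"
  shows "primitive_from a f r - primitive_from a f l = (LINT x|lebesgue_on {l..r}. f x)"
proof -
  have "integrable (lebesgue_on {a..r}) f"
    by (rule integrable_subinterval[OF f]) (use assms in auto)
  from integral_combine[OF this] assms show ?thesis by (simp add: primitive_from_def)
qed

text \<open>The bound uses the open interval because \<open>abs_continuous_on_interval\<close> only
  asks the open intervals to be disjoint, so neighbours may share an endpoint. Dropping the two
  endpoints costs a null set.\<close>

lemma abs_primitive_from_diff_le:
  assumes f: "integrable (lebesgue_on {a..b}) f" and "a \<le> l" "l \<le> r" "r \<le> b"
  shows "\<bar>primitive_from a f r - primitive_from a f l\<bar> \<le> (LINT x:{l<..<r}|lebesgue. \<bar>f x\<bar>)"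
proof -
  have "integrable (lebesgue_on {l..r}) f"
    by (rule integrable_subinterval[OF f]) (use assms in auto)
  have "\<bar>primitive_from a f r - primitive_from a f l\<bar> \<le> (LINT x|lebesgue_on {l..r}. \<bar>f x\<bar>)"
    using primitive_from_diff[OF assms] integral_abs_bound by metis
  also have "\<dots> = (LINT x:{l..r}|lebesgue. \<bar>f x\<bar>)"
    by (simp add: integral_restrict_space set_lebesgue_integral_def)
  also have "\<dots> = (LINT x:{l<..<r}|lebesgue. \<bar>f x\<bar>)"
  proof (rule set_integral_cong_set)
    have "AE x in lebesgue. x \<notin> {l, r}"
      by (intro AE_not_in) (simp flip: negligible_iff_null_sets)
    then show "AE x in lebesgue. (x \<in> {l<..<r}) = (x \<in> {l..r})"
      by eventually_elim auto
    have "set_integrable lebesgue {l..r} (\<lambda>x. \<bar>f x\<bar>)"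
      using \<open>integrable (lebesgue_on {l..r}) f\<close>
      by (intro set_integrable_abs) (simp add: integrable_restrict_space set_integrable_def)
    then show "set_borel_measurable lebesgue {l..r} (\<lambda>x. \<bar>f x\<bar>)"
      by (auto simp: set_integrable_def set_borel_measurable_def)
    then show "set_borel_measurable lebesgue {l<..<r} (\<lambda>x. \<bar>f x\<bar>)"
      by (rule set_borel_measurable_subset) auto
  qed
  finally show ?thesis .
qed

text \<open>The increments are bounded together by the integral of \<open>\<bar>f\<bar>\<close> over
  the union of the disjoint intervals. The measure of that union is the total length, so the
  smallness of integrals over small sets applies.\<close>

lemma abs_continuous_primitive_from:
  assumes f: "integrable (lebesgue_on {a..b}) f"
  shows "abs_continuous_on_interval a b (primitive_from a f)"
  unfolding abs_continuous_on_interval_def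
proof (intro allI impI)
  fix \<epsilon> :: real assume "\<epsilon> > 0"
  have f': "set_integrable lebesgue {a..b} f"
    using f by (simp add: integrable_restrict_space set_integrable_def)
  then have "integrable lebesgue (\<lambda>x. indicator {a..b} x * f x)"
    by (simp add: set_integrable_def)
  from set_integral_abs_small[OF this \<open>\<epsilon> > 0\<close>]
  obtain \<eta> where "\<eta> > 0" and \<eta>: "\<And>A. \<lbrakk>A \<in> sets lebesgue; emeasure lebesgue A < ennreal \<eta>\<rbrakk>
      \<Longrightarrow> (LINT x:A|lebesgue. \<bar>indicator {a..b} x * f x\<bar>) < \<epsilon>" by blast
  show "\<exists>\<eta>>0. \<forall>(n::nat) l r. (\<forall>k<n. a \<le> l k \<and> l k < r k \<and> r k \<le> b) \<and>
        (\<forall>i<n. \<forall>j<n. i \<noteq> j \<longrightarrow> {l i<..<r i} \<inter> {l j<..<r j} = {}) \<and>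
        (\<Sum>k<n. r k - l k) < \<eta>
        \<longrightarrow> (\<Sum>k<n. \<bar>primitive_from a f (r k) - primitive_from a f (l k)\<bar>) < \<epsilon>"
  proof (intro exI conjI allI impI)
    fix n :: nat and l r :: "nat \<Rightarrow> real"
    assume "(\<forall>k<n. a \<le> l k \<and> l k < r k \<and> r k \<le> b) \<and>
        (\<forall>i<n. \<forall>j<n. i \<noteq> j \<longrightarrow> {l i<..<r i} \<inter> {l j<..<r j} = {}) \<and>
        (\<Sum>k<n. r k - l k) < \<eta>"
    then have lr: "\<And>k. k < n \<Longrightarrow> a \<le> l k \<and> l k < r k \<and> r k \<le> b"
      and disj: "disjoint_family_on (\<lambda>k. {l k<..<r k}) {..<n}"
      and len: "(\<Sum>k<n. r k - l k) < \<eta>"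
      by (auto simp: disjoint_family_on_def)
    let ?U = "\<Union>k<n. {l k<..<r k}"
    have "emeasure lebesgue ?U = (\<Sum>k<n. emeasure lebesgue {l k<..<r k})"
      using disj by (intro sum_emeasure[symmetric]) auto
    also have "\<dots> = (\<Sum>k<n. ennreal (r k - l k))"
      using lr by (intro sum.cong) (auto simp: less_imp_le)
    also have "\<dots> = ennreal (\<Sum>k<n. r k - l k)"
      using lr by (intro sum_ennreal) (auto simp: less_imp_le)
    finally have U: "emeasure lebesgue ?U < ennreal \<eta>"
      using len \<open>\<eta> > 0\<close> by (simp add: ennreal_lessI)
    have "(\<Sum>k<n. \<bar>primitive_from a f (r k) - primitive_from a f (l k)\<bar>)
        \<le> (\<Sum>k<n. LINT x:{l k<..<r k}|lebesgue. \<bar>f x\<bar>)"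
      by (intro sum_mono abs_primitive_from_diff_le[OF f]) (use lr in \<open>auto simp: less_imp_le\<close>)
    also have "\<dots> = (LINT x:?U|lebesgue. \<bar>f x\<bar>)"
    proof (rule set_integral_finite_Union[symmetric])
      fix k assume "k \<in> {..<n}"
      then show "set_integrable lebesgue {l k<..<r k} (\<lambda>x. \<bar>f x\<bar>)"
        using lr by (intro set_integrable_subset[OF set_integrable_abs[OF f']]) force+
    qed (use disj in auto)
    \<comment> \<open>\<open>\<eta>\<close> was obtained for \<open>f\<close> cut off outside
      \<open>{a..b}\<close>; all the intervals lie inside, so the cut-off changes nothing.\<close>
    also have "\<dots> = (LINT x:?U|lebesgue. \<bar>indicator {a..b} x * f x\<bar>)"
      by (rule set_lebesgue_integral_cong) (use lr in \<open>auto simp: indicator_def, force+\<close>)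
    also have "\<dots> < \<epsilon>" by (rule \<eta>) (use U in auto)
    finally show "(\<Sum>k<n. \<bar>primitive_from a f (r k) - primitive_from a f (l k)\<bar>) < \<epsilon>" .
  qed (fact \<open>\<eta> > 0\<close>)
qed

section \<open>Almost everywhere differentiability of the primitive\<close>

lemma AE_has_real_derivative_primitive_from:
  assumes f: "integrable (lebesgue_on {a..b}) f"
  shows "AE s in lebesgue_on {a..b}. (primitive_from a f has_real_derivative f s) (at s within {a..b})"
proof -
  \<comment> \<open>Extension by zero makes the function integrable on every compact interval, also
    on those reaching beyond \<open>{a..b}\<close>.\<close>
  define f0 where "f0 = (\<lambda>x. if x \<in> {a..b} then f x else 0)"
  have "f0 integrable_on UNIV"
    unfolding f0_def integrable_restrict_UNIV by (rule integrable_on_lebesgue_on[OF f]) simp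
  then have int0: "f0 integrable_on cbox c d" for c d
    by (rule integrable_on_subcbox) simp
  then have intr: "(\<lambda>x. f0 (- x)) integrable_on cbox c d" for c d
    using Henstock_Kurzweil_Integration.integrable_reflect_real[where f=f0 and a="-d" and b="-c"] by simp
  \<comment> \<open>The library only differentiates to the right; left derivatives come from the
    reflected function.\<close>
  obtain N1 where N1: "negligible N1"
    "\<And>x e. \<lbrakk>x \<notin> N1; 0 < e\<rbrakk> \<Longrightarrow> \<exists>d>0. \<forall>h. 0 < h \<and> h < d \<longrightarrow>
       norm (integral (cbox x (x + h *\<^sub>R One)) f0 /\<^sub>R h ^ DIM(real) - f0 x) < e"
    using integrable_ccontinuous_explicit[OF int0] by blast
  obtain N2 where N2: "negligible N2"
    "\<And>x e. \<lbrakk>x \<notin> N2; 0 < e\<rbrakk> \<Longrightarrow> \<exists>d>0. \<forall>h. 0 < h \<and> h < d \<longrightarrow>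
       norm (integral (cbox x (x + h *\<^sub>R One)) (\<lambda>x. f0 (- x)) /\<^sub>R h ^ DIM(real) - f0 (- x)) < e"
    using integrable_ccontinuous_explicit[OF intr] by blast
  have diff: "primitive_from a f r - primitive_from a f l = integral {l..r} f0"
    if "a \<le> l" "l \<le> r" "r \<le> b" for l r
  proof -
    have "integrable (lebesgue_on {l..r}) f"
      by (rule integrable_subinterval[OF f]) (use that in auto)
    then have "primitive_from a f r - primitive_from a f l = integral {l..r} f"
      using primitive_from_diff[OF f that] by (simp add: lebesgue_integral_eq_integral)
    also have "\<dots> = integral {l..r} f0"
      by (rule integral_cong) (use that in \<open>auto simp: f0_def\<close>)
    finally show ?thesis .
  qed
  have deriv: "(primitive_from a f has_real_derivative f s) (at s within {a..b})"
    if s: "s \<in> {a..b}" "s \<notin> N1" "- s \<notin> N2" for s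
    unfolding has_field_derivative_iff Lim_within
  proof (intro allI impI)
    fix e :: real assume "e > 0"
    obtain d1 where d1: "d1 > 0" "\<And>h. \<lbrakk>0 < h; h < d1\<rbrakk> \<Longrightarrow> \<bar>integral {s..s+h} f0 / h - f s\<bar> < e"
      using N1(2)[OF s(2) \<open>e > 0\<close>] s(1) by (auto simp: f0_def divide_inverse_commute)
    obtain d2 where d2: "d2 > 0"
      "\<And>h. \<lbrakk>0 < h; h < d2\<rbrakk> \<Longrightarrow> \<bar>integral {-s..-s+h} (\<lambda>x. f0 (- x)) / h - f s\<bar> < e"
      using N2(2)[OF s(3) \<open>e > 0\<close>] s(1) by (auto simp: f0_def divide_inverse_commute)
    show "\<exists>d>0. \<forall>y\<in>{a..b}. 0 < dist y s \<and> dist y s < d \<longrightarrow>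
        dist ((primitive_from a f y - primitive_from a f s) / (y - s)) (f s) < e"
    proof (intro exI conjI ballI impI)
      fix y assume y: "y \<in> {a..b}" "0 < dist y s \<and> dist y s < min d1 d2"
      show "dist ((primitive_from a f y - primitive_from a f s) / (y - s)) (f s) < e"
      proof (cases "s < y")
        case True
        then show ?thesis
          using d1(2)[of "y - s"] diff[of s y] y s(1) by (simp add: dist_real_def)
      next
        case False
        \<comment> \<open>Reflection carries \<open>{y..s}\<close> to \<open>{-s..-y}\<close>, which
          starts at \<open>-s\<close>. The minus sign cancels against that of \<open>y - s\<close>,
          leaving a right-hand quotient with step \<open>s - y\<close>.\<close>
        then have "primitive_from a f y - primitive_from a f s
            = - integral {-s..-s + (s - y)} (\<lambda>x. f0 (- x))"
          using diff[of y s] Henstock_Kurzweil_Integration.integral_reflect_real[where f=f0 and a=y and b=s] y s(1) by simp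
        then show ?thesis
          using d2(2)[of "s - y"] False y by (simp add: dist_real_def minus_divide_right)
      qed
    qed (use d1 d2 in auto)
  qed
  \<comment> \<open>The points with \<open>- s \<in> N2\<close> form the reflection of
    \<open>N2\<close>, negligible as a differentiable image of a negligible set.\<close>
  have "negligible (N1 \<union> uminus ` N2)"
    using N1(1) N2(1) by (intro negligible_Un negligible_differentiable_image_negligible) (auto intro!: derivative_intros)
  then have "AE s in lebesgue. s \<notin> N1 \<union> uminus ` N2"
    using negligible_iff_null_sets AE_not_in by blast
  then have "AE s in lebesgue. s \<in> {a..b} \<longrightarrow>
      (primitive_from a f has_real_derivative f s) (at s within {a..b})"
    by eventually_elim (use deriv in \<open>force simp: image_iff\<close>)
  then show ?thesis by (simp add: AE_restrict_space_iff)
qed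

section \<open>Interchanging the order of integration\<close>

text \<open>Moves the dependence on \<open>s\<close> from the measure into the integrand, so that
  the double integral is taken over a fixed product measure.\<close>

lemma primitive_from_eq_integral_indicator:
  assumes "s \<in> {a..b}"
  shows "primitive_from a f s = (LINT r|lebesgue_on {a..b}. indicator {..s} r * f r)"
  unfolding primitive_from_def
  by (subst (1 2) integral_restrict_space)
     (use assms in \<open>auto simp: indicator_def intro!: Bochner_Integration.integral_cong\<close>)

text \<open>Both sides are iterated integrals of \<open>f s * \<beta> r\<close> over the triangle
  \<open>r \<le> s\<close>. Fubini applies because the product \<open>f s * \<beta> r\<close> is
  integrable on the whole square and dominates the restriction to the triangle.\<close>

lemma
  fixes f \<beta> :: "real \<Rightarrow> real"
  assumes f: "integrable (lebesgue_on {a..b}) f" and \<beta>: "integrable (lebesgue_on {a..b}) \<beta>"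
  shows integrable_mult_primitive_from:
      "integrable (lebesgue_on {a..b}) (\<lambda>s. f s * primitive_from a \<beta> s)" (is ?A)
    and integral_mult_primitive_from:
      "(LINT s|lebesgue_on {a..b}. f s * primitive_from a \<beta> s)
        = (LINT r|lebesgue_on {a..b}. \<beta> r * (primitive_from a f b - primitive_from a f r))" (is ?B)
proof -
  define M where "M = lebesgue_on {a..b}"
  have [measurable]: "f \<in> borel_measurable M" "\<beta> \<in> borel_measurable M"
    using f \<beta> by (auto simp: M_def)
  have [measurable]: "(\<lambda>x. x) \<in> borel_measurable M"
    unfolding M_def by (intro measurable_restrict_space1 measurable_completion) simp
  have [simp]: "space M = {a..b}" by (simp add: M_def)
  interpret finite_measure M
    unfolding M_def by (rule finite_measure_lebesgue_on) simp
  interpret pair_sigma_finite M M ..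
  let ?k = "\<lambda>s r. f s * (indicator {..s} r * \<beta> r)"
  have meas[measurable]: "(\<lambda>(s,r). ?k s r) \<in> borel_measurable (M \<Otimes>\<^sub>M M)"
  proof -
    \<comment> \<open>The set in \<open>indicator {..s} r\<close> varies with \<open>s\<close>. The
      conditional form reduces joint measurability to comparing the two coordinates, each a
      measurable function on \<open>M\<close>.\<close>
    have "(\<lambda>(s,r). f s * ((if r \<le> s then 1 else 0) * \<beta> r)) \<in> borel_measurable (M \<Otimes>\<^sub>M M)"
      by measurable
    moreover have "(\<lambda>(s,r). ?k s r) = (\<lambda>(s,r). f s * ((if r \<le> s then 1 else 0) * \<beta> r))"
      by (auto simp: indicator_def)
    ultimately show ?thesis by simp
  qed
  have int: "integrable (M \<Otimes>\<^sub>M M) (\<lambda>(s,r). ?k s r)"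
  proof (rule Bochner_Integration.integrable_bound)
    show "integrable (M \<Otimes>\<^sub>M M) (\<lambda>(s,r). f s * \<beta> r)"
      using f \<beta> by (intro Fubini_integrable) (auto simp: M_def[symmetric] abs_mult)
  qed (auto simp: indicator_def abs_mult)
  have inner: "(LINT r|M. indicator {..s} r * \<beta> r) = primitive_from a \<beta> s" if "s \<in> {a..b}" for s
    using primitive_from_eq_integral_indicator[OF that, of \<beta>] by (simp add: M_def)
  have "integrable M (\<lambda>s. LINT r|M. ?k s r)"
    using integrable_fst'[OF int] by simp
  then show ?A
    unfolding M_def[symmetric] by (rule Bochner_Integration.integrable_cong[THEN iffD1, rotated 2]) (auto simp: inner)
  have swap: "(LINT s|M. ?k s r) = \<beta> r * (primitive_from a f b - primitive_from a f r)"
    if r: "r \<in> {a..b}" for r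
  proof -
    \<comment> \<open>For fixed \<open>r\<close>, the condition \<open>r \<le> s\<close> is read as
      a condition on \<open>s\<close>.\<close>
    have "(LINT s|M. ?k s r) = (LINT s|M. \<beta> r * (indicator {r..} s * f s))"
      by (rule Bochner_Integration.integral_cong) (auto simp: indicator_def)
    also have "\<dots> = \<beta> r * (LINT s|M. indicator {r..} s * f s)"
      by simp
    also have "(LINT s|M. indicator {r..} s * f s) = (LINT s|lebesgue_on {r..b}. f s)"
      unfolding M_def
      by (subst (1 2) integral_restrict_space)
         (use r in \<open>auto simp: indicator_def intro!: Bochner_Integration.integral_cong\<close>)
    also have "\<dots> = primitive_from a f b - primitive_from a f r"
      using primitive_from_diff[OF f, of r b] r by simp
    finally show "(LINT s|M. ?k s r) = \<beta> r * (primitive_from a f b - primitive_from a f r)" .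
  qed
  have "(LINT s|M. f s * primitive_from a \<beta> s) = (LINT s|M. LINT r|M. ?k s r)"
    by (rule Bochner_Integration.integral_cong) (auto simp: inner)
  also have "\<dots> = (LINT r|M. LINT s|M. ?k s r)"
    using Fubini_integral[OF int] by simp
  also have "\<dots> = (LINT r|M. \<beta> r * (primitive_from a f b - primitive_from a f r))"
    by (intro Bochner_Integration.integral_cong refl swap) simp
  finally show ?B by (simp add: M_def)
qed

section \<open>Functions orthogonal to all admissible mean-zero test functions\<close>

text \<open>A nonnegative function with integral zero vanishes almost everywhere, which contradicts
  strict positivity unless the measure is zero. The last assumption says that it is not.\<close>

lemma integral_pos_if_AE_pos:
  fixes u :: "'a \<Rightarrow> real"
  assumes u: "integrable M u" and pos: "AE x in M. u x > 0" and "\<not> (AE x in M. False)"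
  shows "integral\<^sup>L M u > 0"
proof (rule ccontr)
  have nn: "AE x in M. 0 \<le> u x" using pos by eventually_elim auto
  assume "\<not> ?thesis"
  then have "integral\<^sup>L M u = 0" using integral_nonneg_AE[OF nn] by simp
  then have "AE x in M. u x = 0" using integral_nonneg_eq_0_iff_AE[OF u nn] by simp
  with pos have "AE x in M. False" by eventually_elim auto
  with assms(3) show False ..
qed

text \<open>A weighted form of the du Bois-Reymond lemma. Since \<open>h\<close> is only integrable,
  the test function is built from the bounded increasing function \<open>arctan\<close> of
  \<open>h\<close>; the bound \<open>K\<close> then makes \<open>h * \<beta>\<close>
  integrable.\<close>

lemma AE_const_if_orthogonal:
  fixes h \<delta> :: "'a \<Rightarrow> real"
  assumes h: "integrable M h" and \<delta>: "integrable M \<delta>" and bd: "AE x in M. \<bar>\<delta> x\<bar> \<le> K"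
    and pos: "AE x in M. \<delta> x > 0"
    and orth: "\<And>\<beta>. \<lbrakk>\<beta> \<in> borel_measurable M; AE x in M. \<bar>\<beta> x\<bar> \<le> \<delta> x; integral\<^sup>L M \<beta> = 0\<rbrakk>
       \<Longrightarrow> (LINT x|M. h x * \<beta> x) = 0"
  shows "\<exists>c. AE x in M. h x = c"
proof (cases "AE x in M. False")
  case True
  then show ?thesis by (auto elim: eventually_mono)
next
  case False
  have [measurable]: "h \<in> borel_measurable M" "\<delta> \<in> borel_measurable M" using h \<delta> by auto
  have arctan_abs: "\<bar>arctan y\<bar> \<le> pi/2" for y using arctan_bounded[of y] by auto
  have i: "integrable M (\<lambda>x. \<delta> x * arctan (h x))"
  proof (rule Bochner_Integration.integrable_bound)
    show "integrable M (\<lambda>x. (pi/2) * \<delta> x)" using \<delta> by simp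
    show "AE x in M. norm (\<delta> x * arctan (h x)) \<le> norm (pi/2 * \<delta> x)"
    proof (rule AE_I2)
      fix x
      show "norm (\<delta> x * arctan (h x)) \<le> norm (pi/2 * \<delta> x)"
        using mult_right_mono[OF arctan_abs[of "h x"], of "\<bar>\<delta> x\<bar>"] by (simp add: abs_mult mult.commute)
    qed
  qed measurable
  define D where "D = integral\<^sup>L M \<delta>"
  have "D > 0" unfolding D_def by (rule integral_pos_if_AE_pos[OF \<delta> pos False])
  define m where "m = (LINT x|M. \<delta> x * arctan (h x)) / D"
  \<comment> \<open>The weighted mean \<open>m\<close> must lie strictly between
    \<open>-pi/2\<close> and \<open>pi/2\<close> to be a value of \<open>arctan\<close>. Strictness
    survives integration because \<open>\<delta>\<close> is positive almost everywhere and the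
    measure is nonzero.\<close>
  have "(LINT x|M. \<delta> x * (pi/2) - \<delta> x * arctan (h x)) > 0"
  proof (rule integral_pos_if_AE_pos[OF _ _ False])
    show "AE x in M. \<delta> x * (pi/2) - \<delta> x * arctan (h x) > 0"
      using pos by eventually_elim (use arctan_ubound in \<open>auto simp del: times_divide_eq_right intro!: mult_strict_left_mono\<close>)
  qed (use \<delta> i in auto)
  then have "(LINT x|M. \<delta> x * arctan (h x)) < D * (pi/2)"
    using \<delta> i by (simp add: D_def del: times_divide_eq_right)
  then have "m < pi/2" using \<open>D > 0\<close> by (simp add: m_def field_simps)
  have "(LINT x|M. \<delta> x * arctan (h x) - \<delta> x * (-pi/2)) > 0"
  proof (rule integral_pos_if_AE_pos[OF _ _ False])
    show "AE x in M. \<delta> x * arctan (h x) - \<delta> x * (-pi/2) > 0"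
      using pos
    proof eventually_elim
      case (elim x)
      then have "\<delta> x * (-pi/2) < \<delta> x * arctan (h x)"
        using arctan_lbound[of "h x"] by (intro mult_strict_left_mono) auto
      then show ?case by simp
    qed
  qed (use \<delta> i in auto)
  then have "D * (-pi/2) < (LINT x|M. \<delta> x * arctan (h x))"
    using \<delta> i by (simp add: D_def del: times_divide_eq_right)
  then have "-(pi/2) < m" using \<open>D > 0\<close> by (simp add: m_def field_simps)
  define c where "c = tan m"
  have c: "arctan c = m"
    using \<open>m < pi/2\<close> \<open>-(pi/2) < m\<close> by (simp add: c_def arctan_tan)
  \<comment> \<open>Both \<open>arctan (h x)\<close> and \<open>m\<close> have absolute value at
    most \<open>pi/2\<close>, so their difference is at most \<open>pi < 4\<close>; dividing by 4
    gives \<open>\<bar>\<beta>\<bar> \<le> \<delta>\<close>.\<close>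
  define \<beta> where "\<beta> = (\<lambda>x. \<delta> x * (arctan (h x) - m) / 4)"
  have [measurable]: "\<beta> \<in> borel_measurable M" unfolding \<beta>_def by measurable
  have bdd: "AE x in M. \<bar>\<beta> x\<bar> \<le> \<delta> x"
    using pos
  proof eventually_elim
    case (elim x)
    have "\<bar>arctan (h x) - m\<bar> \<le> 4"
      using arctan_abs[of "h x"] \<open>m < pi/2\<close> \<open>-(pi/2) < m\<close> pi_less_4 by linarith
    then have "\<delta> x * \<bar>arctan (h x) - m\<bar> \<le> \<delta> x * 4" using elim by (intro mult_left_mono) auto
    then show ?case using elim by (simp add: \<beta>_def abs_mult)
  qed
  have i\<beta>: "integrable M \<beta>"
    unfolding \<beta>_def right_diff_distrib using \<delta> i by auto
  have "integral\<^sup>L M \<beta> = 0"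
    unfolding \<beta>_def right_diff_distrib using \<delta> i \<open>D > 0\<close> by (simp add: m_def D_def)
  then have "(LINT x|M. h x * \<beta> x) = 0" by (intro orth bdd) auto
  have ih: "integrable M (\<lambda>x. h x * \<beta> x)"
  proof (rule Bochner_Integration.integrable_bound)
    show "integrable M (\<lambda>x. K * h x)" using h by simp
    show "AE x in M. norm (h x * \<beta> x) \<le> norm (K * h x)"
      using bdd bd
    proof eventually_elim
      case (elim x)
      then have "\<bar>h x\<bar> * \<bar>\<beta> x\<bar> \<le> \<bar>h x\<bar> * \<bar>K\<bar>" by (intro mult_left_mono) auto
      then show ?case by (simp add: abs_mult mult.commute)
    qed
  qed measurable
  \<comment> \<open>Subtracting \<open>c\<close> is free because \<open>\<beta>\<close> has mean
    zero.\<close>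
  have "(LINT x|M. (h x - c) * \<beta> x) = 0"
    using ih i\<beta> \<open>integral\<^sup>L M \<beta> = 0\<close> \<open>(LINT x|M. h x * \<beta> x) = 0\<close> by (simp add: left_diff_distrib)
  moreover have "AE x in M. 0 \<le> (h x - c) * \<beta> x"
    using pos
  proof eventually_elim
    case (elim x)
    have "0 \<le> (h x - c) * (arctan (h x) - arctan c)"
      by (cases "h x \<le> c") (auto intro: mult_nonneg_nonneg mult_nonpos_nonpos simp: arctan_le_iff)
    then have "0 \<le> \<delta> x * ((h x - c) * (arctan (h x) - m))" using elim c by simp
    then show ?case by (simp add: \<beta>_def algebra_simps)
  qed
  moreover have "integrable M (\<lambda>x. (h x - c) * \<beta> x)"
    using ih i\<beta> by (simp add: left_diff_distrib)
  ultimately have "AE x in M. (h x - c) * \<beta> x = 0"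
    using integral_nonneg_eq_0_iff_AE by blast
  \<comment> \<open>Where \<open>\<delta> x > 0\<close>, the product vanishes only if
    \<open>h x = c\<close> or \<open>arctan (h x) = arctan c\<close>, and \<open>arctan\<close> is
    injective.\<close>
  with pos have "AE x in M. h x = c"
  proof eventually_elim
    case (elim x)
    then show ?case by (auto simp: \<beta>_def c[symmetric] arctan_eq_iff)
  qed
  then show ?thesis ..
qed

section \<open>Essential bounds and the proof of the theorem\<close>

lemma Linfinity_AE_bounded:
  assumes "\<delta> \<in> Linfinity M"
  obtains K where "AE x in M. \<bar>\<delta> x\<bar> \<le> K"
proof -
  from assms have lt: "esssup M (\<lambda>x. ereal \<bar>\<delta> x\<bar>) < \<infinity>" by (simp add: Linfinity_def)
  \<comment> \<open>A real number strictly above the essential supremum is available even if the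
    latter is \<open>-\<infinity>\<close>, as happens for the zero measure.\<close>
  then obtain K where K: "esssup M (\<lambda>x. ereal \<bar>\<delta> x\<bar>) < ereal K"
    using ereal_dense2 by blast
  have "AE x in M. ereal \<bar>\<delta> x\<bar> \<le> esssup M (\<lambda>x. ereal \<bar>\<delta> x\<bar>)" by (rule esssup_AE)
  then have "AE x in M. \<bar>\<delta> x\<bar> \<le> K"
  proof eventually_elim
    case (elim x)
    then have "ereal \<bar>\<delta> x\<bar> < ereal K" using K by (rule le_less_trans)
    then show ?case by simp
  qed
  then show thesis ..
qed

lemma LinfinityI:
  assumes [measurable]: "\<beta> \<in> borel_measurable M" and "AE x in M. \<bar>\<beta> x\<bar> \<le> K"
  shows "\<beta> \<in> Linfinity M"
proof -
  have "esssup M (\<lambda>x. ereal \<bar>\<beta> x\<bar>) \<le> ereal K"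
    using assms by (intro esssup_I) auto
  then show ?thesis by (auto simp: Linfinity_def intro: le_less_trans)
qed

theorem theorem2p1:
  fixes a b :: real and f g \<delta> :: "real \<Rightarrow> real"
  assumes "a < b"
    and "integrable (lebesgue_on {a..b}) f"
    and "integrable (lebesgue_on {a..b}) g"
    and "\<delta> \<in> Linfinity (lebesgue_on {a..b})"
    and "AE s in lebesgue_on {a..b}. \<delta> s > 0"
    and "\<forall>\<beta> \<in> Omega a b \<delta>.
           (LINT s|lebesgue_on {a..b}. f s * primitive_from a \<beta> s + g s * \<beta> s) = 0"
  shows "\<exists>gt :: real \<Rightarrow> real.
           (AE s in lebesgue_on {a..b}. gt s = g s) \<and>
           continuous_on {a..b} gt \<and>
           abs_continuous_on_interval a b gt \<and>
           (AE s in lebesgue_on {a..b}.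
              (gt has_real_derivative f s) (at s within {a..b}))"
proof -
  let ?M = "lebesgue_on {a..b}"
  let ?F = "primitive_from a f"
  interpret finite_measure ?M by (rule finite_measure_lebesgue_on) simp
  note f = assms(2) and g = assms(3)
  obtain K where K: "AE s in ?M. \<bar>\<delta> s\<bar> \<le> K"
    using Linfinity_AE_bounded[OF assms(4)] .
  have \<delta>m: "\<delta> \<in> borel_measurable ?M" using assms(4) by (simp add: Linfinity_def)
  have \<delta>: "integrable ?M \<delta>"
    by (rule integrable_const_bound[of _ K]) (use K \<delta>m in auto)
  have cont: "continuous_on {a..b} ?F"
    unfolding primitive_from_def by (rule indefinite_integral_continuous_real[OF f])
  have F: "integrable ?M ?F"
    by (rule continuous_imp_integrable_real[OF cont])
  have "\<exists>c. AE s in ?M. g s - ?F s = c"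
  proof (rule AE_const_if_orthogonal[OF _ \<delta> K assms(5)])
    show "integrable ?M (\<lambda>s. g s - ?F s)" using g F by simp
    fix \<beta> assume \<beta>m: "\<beta> \<in> borel_measurable ?M" and \<beta>\<delta>: "AE s in ?M. \<bar>\<beta> s\<bar> \<le> \<delta> s"
      and \<beta>0: "integral\<^sup>L ?M \<beta> = 0"
    have \<beta>K: "AE s in ?M. \<bar>\<beta> s\<bar> \<le> K"
      using \<beta>\<delta> K by eventually_elim auto
    have \<beta>: "integrable ?M \<beta>"
      by (rule integrable_const_bound[of _ K]) (use \<beta>K \<beta>m in auto)
    \<comment> \<open>Used with \<open>u = g\<close> and \<open>u = ?F\<close>, so that the
      integrals below may be split.\<close>
    have prod: "integrable ?M (\<lambda>s. u s * \<beta> s)" if u: "integrable ?M u" for u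
    proof (rule Bochner_Integration.integrable_bound)
      show "integrable ?M (\<lambda>s. K * u s)" using u by simp
      show "AE s in ?M. norm (u s * \<beta> s) \<le> norm (K * u s)"
        using \<beta>K
      proof eventually_elim
        case (elim s)
        then have "\<bar>u s\<bar> * \<bar>\<beta> s\<bar> \<le> \<bar>u s\<bar> * \<bar>K\<bar>" by (intro mult_left_mono) auto
        then show ?case by (simp add: abs_mult mult.commute)
      qed
    qed (use u \<beta>m in auto)
    have "\<beta> \<in> Omega a b \<delta>"
      using LinfinityI[OF \<beta>m \<beta>K] \<beta>\<delta> \<beta>0 by (simp add: Omega_def)
    then have "0 = (LINT s|?M. f s * primitive_from a \<beta> s + g s * \<beta> s)"
      using assms(6) by simp
    also have "\<dots> = (LINT s|?M. \<beta> s * (?F b - ?F s)) + (LINT s|?M. g s * \<beta> s)"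
      using integrable_mult_primitive_from[OF f \<beta>] integral_mult_primitive_from[OF f \<beta>] prod[OF g]
      by simp
    \<comment> \<open>The constant \<open>?F b\<close> contributes nothing, since
      \<open>\<beta>\<close> has integral zero.\<close>
    also have "(LINT s|?M. \<beta> s * (?F b - ?F s)) = - (LINT s|?M. ?F s * \<beta> s)"
      using \<beta> prod[OF F] \<beta>0 by (simp add: right_diff_distrib mult.commute[of "\<beta> _"])
    finally show "(LINT s|?M. (g s - ?F s) * \<beta> s) = 0"
      using prod[OF g] prod[OF F] by (simp add: left_diff_distrib)
  qed
  then obtain c where c: "AE s in ?M. g s - ?F s = c" ..
  show ?thesis
  proof (intro exI conjI)
    show "AE s in ?M. ?F s + c = g s" using c by eventually_elim auto
    show "continuous_on {a..b} (\<lambda>s. ?F s + c)" using cont by (intro continuous_intros)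
    \<comment> \<open>The constant \<open>c\<close> cancels in every increment.\<close>
    show "abs_continuous_on_interval a b (\<lambda>s. ?F s + c)"
      using abs_continuous_primitive_from[OF f] by (simp add: abs_continuous_on_interval_def)
    show "AE s in ?M. ((\<lambda>s. ?F s + c) has_real_derivative f s) (at s within {a..b})"
      using AE_has_real_derivative_primitive_from[OF f]
      by eventually_elim (auto intro!: derivative_eq_intros)
  qed
qed

end
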